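(* Let $N$ be a positive integer and let $\alpha,\beta,\zeta$ be real parameters that are generic (no denominator appearing in the formulas of the context or below vanishes). For $m,n\in\{0,\dots,N\}$ let $U_m(n)=\langle e_m|d_n^*\rangle$ and $\widetilde U_m(n)=\langle e_m^*|Z|d_n\rangle$, with the vectors and the operator $Z$ on $\mathbb R^{N+1}$ given in the context. Then for all $m,n\in\{0,\dots,N\}$ $$U_m(n)=\frac{(\alpha-\beta-n)_n\,(-N,N-2\alpha-\beta-2\zeta)_m}{n!\,(-\alpha)_{n+1}\,(m-2\beta-2\zeta-1)_m}\;\mathcal U_m(n;\alpha,\beta,\zeta,N),$$ $$\widetilde U_m(n)=\frac{(n-\alpha)\,(-N+\alpha+\beta+2\zeta,\,-N+2\alpha-\beta)_{N-n}\,(m+1,\,-2N+2\alpha+\beta+2\zeta+1)_{N-m}}{(n-N,\,n-\alpha,\,-2N+2\alpha+\beta+2\zeta+1)_{N-n}\,(-N-m+2\beta+2\zeta+1)_{N-m}}\;\widetilde{\mathcal U}_m(n;\alpha,\beta,\zeta,N).$$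
   Context: Notation: $(a)_n=a(a+1)\cdots(a+n-1)$, $(a)_0=1$, and $(a_1,\dots,a_k)_n=(a_1)_n\cdots(a_k)_n$. For $m,n\in\{0,\dots,N\}$ the rational functions of Racah type are $$\mathcal U_m(n;a,b,c,N)={}_4F_3\left({-m,\ -n,\ -a,\ m-2b-2c-1\atop -N,\ a-b-n,\ N-2a-b-2c};1\right)=\sum_{\ell=0}^{\min(m,n)}\frac{(-m,-n,-a,m-2b-2c-1)_\ell}{\ell!\,(-N,a-b-n,N-2a-b-2c)_\ell},$$ $$\widetilde{\mathcal U}_m(n;a,b,c,N)=\mathcal U_m(N-n;\,N-a-1,\,b+2c-2,\,2-c,\,N).$$ Let $|0\rangle,\dots,|N\rangle$ be the standard orthonormal basis of $\mathbb R^{N+1}$ and $\langle v|w\rangle$ the standard real scalar product. Consider the operators (with $|N+1\rangle=|-1\rangle=0$) $$Z|n\rangle=(n-\alpha)|n\rangle+|n+1\rangle,\qquad X|n\rangle=-(n-\alpha)^2|n\rangle-(n-\beta)|n+1\rangle,$$ $$V|n\rangle=(n-\beta-\zeta-1)(\beta+\zeta-n)|n\rangle+n(N+1-n)(n-1-2\alpha-\beta-2\zeta+N)|n-1\rangle .$$ The vectors $|e_n\rangle$, $|e_n^*\rangle$ are eigenvectors of $V$, $V^\top$ with eigenvalue $(n-\beta-\zeta-1)(\beta+\zeta-n)$, and $|d_n\rangle$, $|d_n^*\rangle$ solve the generalized eigenvalue problems $X|d_n\rangle=(\alpha-n)Z|d_n\rangle$, $X^\top|d_n^*\rangle=(\alpha-n)Z^\top|d_n^*\rangle$,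 normalized as $$|e_n\rangle=\frac{(-N,N-2\alpha-\beta-2\zeta)_n}{(n-2\beta-2\zeta-1)_n}\sum_{\ell=0}^{N}(-1)^\ell\frac{(-n,n-2\beta-2\zeta-1)_\ell}{\ell!\,(-N,N-2\alpha-\beta-2\zeta)_\ell}|\ell\rangle,$$ $$|e_n^*\rangle=\frac{(-N,n+N-2\alpha-\beta-2\zeta)_{N-n}}{(2\beta+2\zeta-N-n+1)_{N-n}}\sum_{\ell=0}^{N}\frac{(n-N,2\beta+2\zeta-N-n+1)_{N-\ell}}{(N-\ell)!\,(-N,2\alpha+\beta+2\zeta-2N+1)_{N-\ell}}|\ell\rangle,$$ $$|d_n\rangle=\frac{(n-N-\alpha+\beta+1)_{N-n}}{(n-N,\alpha-N)_{N-n}}\sum_{\ell=0}^{N}\frac{(n-N,\alpha-N)_{N-\ell}}{(n-N-\alpha+\beta+1)_{N-\ell}}|\ell\rangle,$$ $$|d_n^*\rangle=\frac{(-n+\alpha-\beta)_n}{n!\,(-\alpha)_{n+1}}\sum_{\ell=0}^{N}(-1)^\ell\frac{(-n,-\alpha)_\ell}{(-n+\alpha-\beta)_\ell}|\ell\rangle .$$ *)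

theory Defs
  imports Complex_Main "Jordan_Normal_Form.Matrix"
begin

text \<open>The space \<open>\<real>\<^bsup>N+1\<^esup>\<close> is the carrier \<open>carrier_vec (N + 1)\<close>, with basis vectors
  \<open>|n\<rangle> = unit_vec (N + 1) n\<close> and the scalar product of vectors as \<open>\<langle>v|w\<rangle>\<close>.\<close>

text \<open>\<open>mpoch [a\<^sub>1, \<dots>, a\<^sub>k] n\<close> is the product \<open>(a\<^sub>1, \<dots>, a\<^sub>k)\<^sub>n\<close> of rising factorials.\<close>

definition mpoch :: "real list \<Rightarrow> nat \<Rightarrow> real" where
  "mpoch as n = (\<Prod>a\<leftarrow>as. pochhammer a n)"

text \<open>The terminating series \<open>\<^sub>4F\<^sub>3\<close> is cut off at \<open>min m n\<close>, after which its numerators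
  vanish: the parameter \<open>-N\<close> in the denominator would otherwise produce 0/0.\<close>

definition racah_U :: "nat \<Rightarrow> nat \<Rightarrow> real \<Rightarrow> real \<Rightarrow> real \<Rightarrow> nat \<Rightarrow> real" where
  "racah_U m n a b c N =
     (\<Sum>l = 0..min m n.
        mpoch [- real m, - real n, - a, real m - 2 * b - 2 * c - 1] l
        / (fact l * mpoch [- real N, a - b - real n, real N - 2 * a - b - 2 * c] l))"

definition racah_U_tilde :: "nat \<Rightarrow> nat \<Rightarrow> real \<Rightarrow> real \<Rightarrow> real \<Rightarrow> nat \<Rightarrow> real" where
  "racah_U_tilde m n a b c N =
     racah_U m (N - n) (real N - a - 1) (b + 2 * c - 2) (2 - c) N"

text \<open>The columns of the matrix are the images \<open>Z|n\<rangle>\<close>.  In the last one the term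
  \<open>unit_vec (N + 1) (N + 1)\<close> is the zero vector, in accordance with \<open>|N+1\<rangle> = 0\<close>.\<close>

definition Z_mat :: "real \<Rightarrow> nat \<Rightarrow> real mat" where
  "Z_mat \<alpha> N =
     mat_of_cols (N + 1)
       (map (\<lambda>n. (real n - \<alpha>) \<cdot>\<^sub>v unit_vec (N + 1) n + unit_vec (N + 1) (n + 1)) [0..<N + 1])"

definition e_vec :: "real \<Rightarrow> real \<Rightarrow> real \<Rightarrow> nat \<Rightarrow> nat \<Rightarrow> real vec" where
  "e_vec \<alpha> \<beta> \<zeta> N n =
     (mpoch [- real N, real N - 2 * \<alpha> - \<beta> - 2 * \<zeta>] n
      / pochhammer (real n - 2 * \<beta> - 2 * \<zeta> - 1) n) \<cdot>\<^sub>v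
     vec (N + 1) (\<lambda>l.
       (-1) ^ l * (mpoch [- real n, real n - 2 * \<beta> - 2 * \<zeta> - 1] l
       / (fact l * mpoch [- real N, real N - 2 * \<alpha> - \<beta> - 2 * \<zeta>] l)))"

definition e_dual_vec :: "real \<Rightarrow> real \<Rightarrow> real \<Rightarrow> nat \<Rightarrow> nat \<Rightarrow> real vec" where
  "e_dual_vec \<alpha> \<beta> \<zeta> N n =
     (mpoch [- real N, real n + real N - 2 * \<alpha> - \<beta> - 2 * \<zeta>] (N - n)
      / pochhammer (2 * \<beta> + 2 * \<zeta> - real N - real n + 1) (N - n)) \<cdot>\<^sub>v
     vec (N + 1) (\<lambda>l.
       mpoch [real n - real N, 2 * \<beta> + 2 * \<zeta> - real N - real n + 1] (N - l)
       / (fact (N - l) * mpoch [- real N, 2 * \<alpha> + \<beta> + 2 * \<zeta> - 2 * real N + 1] (N - l)))"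

definition d_vec :: "real \<Rightarrow> real \<Rightarrow> nat \<Rightarrow> nat \<Rightarrow> real vec" where
  "d_vec \<alpha> \<beta> N n =
     (pochhammer (real n - real N - \<alpha> + \<beta> + 1) (N - n)
      / mpoch [real n - real N, \<alpha> - real N] (N - n)) \<cdot>\<^sub>v
     vec (N + 1) (\<lambda>l.
       mpoch [real n - real N, \<alpha> - real N] (N - l)
       / pochhammer (real n - real N - \<alpha> + \<beta> + 1) (N - l))"

definition d_dual_vec :: "real \<Rightarrow> real \<Rightarrow> nat \<Rightarrow> nat \<Rightarrow> real vec" where
  "d_dual_vec \<alpha> \<beta> N n =
     (pochhammer (- real n + \<alpha> - \<beta>) n / (fact n * pochhammer (- \<alpha>) (n + 1))) \<cdot>\<^sub>v
     vec (N + 1) (\<lambda>l.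
       (-1) ^ l * (mpoch [- real n, - \<alpha>] l / pochhammer (- real n + \<alpha> - \<beta>) l))"

text \<open>Genericity: for all indices in \<open>{0..N}\<close>, no denominator vanishes in the four families of
  vectors, in the two Racah functions at the parameters \<open>\<alpha>, \<beta>, \<zeta>\<close>, and in the prefactors of
  the two overlaps.  Factorials are omitted.\<close>

definition racah_U_defined :: "nat \<Rightarrow> nat \<Rightarrow> real \<Rightarrow> real \<Rightarrow> real \<Rightarrow> nat \<Rightarrow> bool" where
  "racah_U_defined m n a b c N \<longleftrightarrow>
     (\<forall>l\<le>min m n. mpoch [- real N, a - b - real n, real N - 2 * a - b - 2 * c] l \<noteq> 0)"

definition generic :: "real \<Rightarrow> real \<Rightarrow> real \<Rightarrow> nat \<Rightarrow> bool" where
  "generic \<alpha> \<beta> \<zeta> N \<longleftrightarrow>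
     \<comment> \<open>vectors\<close>
     (\<forall>n\<le>N. pochhammer (real n - 2 * \<beta> - 2 * \<zeta> - 1) n \<noteq> 0
        \<and> pochhammer (2 * \<beta> + 2 * \<zeta> - real N - real n + 1) (N - n) \<noteq> 0
        \<and> mpoch [real n - real N, \<alpha> - real N] (N - n) \<noteq> 0
        \<and> pochhammer (- \<alpha>) (n + 1) \<noteq> 0)
   \<and> (\<forall>l\<le>N. mpoch [- real N, real N - 2 * \<alpha> - \<beta> - 2 * \<zeta>] l \<noteq> 0
        \<and> mpoch [- real N, 2 * \<alpha> + \<beta> + 2 * \<zeta> - 2 * real N + 1] (N - l) \<noteq> 0)
   \<and> (\<forall>n\<le>N. \<forall>l\<le>N. pochhammer (real n - real N - \<alpha> + \<beta> + 1) (N - l) \<noteq> 0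
        \<and> pochhammer (- real n + \<alpha> - \<beta>) l \<noteq> 0)
     \<comment> \<open>Racah functions\<close>
   \<and> (\<forall>m\<le>N. \<forall>n\<le>N. racah_U_defined m n \<alpha> \<beta> \<zeta> N
        \<and> racah_U_defined m (N - n) (real N - \<alpha> - 1) (\<beta> + 2 * \<zeta> - 2) (2 - \<zeta>) N)
     \<comment> \<open>prefactors not already covered\<close>
   \<and> (\<forall>n\<le>N. mpoch [real n - real N, real n - \<alpha>,
                   - 2 * real N + 2 * \<alpha> + \<beta> + 2 * \<zeta> + 1] (N - n) \<noteq> 0)
   \<and> (\<forall>m\<le>N. pochhammer (- real N - real m + 2 * \<beta> + 2 * \<zeta> + 1) (N - m) \<noteq> 0)"

end

theory Submission
  imports Defs
begin

text \<open>
  The first overlap needs no summation theorem.  The entries of \<open>|e\<^sub>m\<rangle>\<close> and \<open>|d\<^sub>n\<^sup>*\<rangle>\<close> are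
  hypergeometric terms whose alternating signs cancel, so their products are, up to a constant,
  the terms of the series \<open>racah_U m n\<close>, and all terms beyond \<open>min m n\<close> vanish.

  For the second overlap put \<open>k = N - l\<close>.  The matrix \<open>Z\<close> adds to each entry of \<open>|d\<^sub>n\<rangle>\<close>, weighted
  by \<open>l - \<alpha>\<close>, the entry before it, and the two terms merge into a single hypergeometric term
  (\<open>Z_mat_mult_d_vec\<close>).  The overlap is thus a constant times the terminating balanced series
  \[ {}_4F_3(n-N,\ \alpha-N+1,\ m-N,\ 2\beta+2\zeta-N-m+1;\
      -N,\ 2\alpha+\beta+2\zeta-2N+1,\ n-N-\alpha+\beta+2;\ 1), \]
  and Whipple's transformation that fixes the two numerator parameters \<open>n - N\<close>, \<open>\<alpha> - N + 1\<close> and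
  the denominator parameter \<open>-N\<close> turns it into the series of \<open>racah_U_tilde m n\<close> (\<open>whipple_4F3\<close>).
  It remains to compare the constants, by reflecting rising factorials.

  Whipple's transformation is obtained in the classical way from the Pfaff--Saalschuetz sum, used
  twice: once to expand \<open>(b)\<^sub>k(c)\<^sub>k/(d)\<^sub>k\<close>, once to evaluate the inner sum after exchanging the
  order of summation.  The parameter \<open>-N\<close> below and the vanishing of some rising factorials
  make the usual statements with quotients awkward, so these sums are first put in a form where
  at most \<open>(d)\<^sub>k\<close> is inverted.
\<close>

section \<open>The Pfaff--Saalschuetz sum\<close>

text \<open>
  Induction on \<open>n\<close> by the method of Wilf and Zeilberger.  With \<open>F n j\<close> the summand and
  \<open>s = d - x - y\<close>, the certificate is \<open>G j = j (s + n - j) F n j\<close>: passing from \<open>n\<close> to \<open>n + 1\<close>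
  multiplies the right-hand side by \<open>(d - x + n) (d - y + n)\<close>, and the summand \<open>F (n + 1) j\<close>, split
  by Pascal's rule, agrees with \<open>(d - x + n) (d - y + n) F n j\<close> up to a telescoping difference of
  \<open>G\<close> and a shift of the summation index.
\<close>

lemma saalschuetz:
  fixes x y d :: "'a::comm_ring_1"
  shows "(\<Sum>j\<le>n. of_nat (n choose j) * pochhammer x j * pochhammer y j
            * pochhammer (d + of_nat j) (n - j) * pochhammer (d - x - y) (n - j))
         = pochhammer (d - x) n * pochhammer (d - y) n"
proof (induction n)
  case 0
  show ?case by simp
next
  case (Suc n)
  define s where "s = d - x - y"
  define F where "F n j = of_nat (n choose j) * pochhammer x j * pochhammer y j
     * pochhammer (d + of_nat j) (n - j) * pochhammer s (n - j)" for n j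
  define B where "B j = of_nat (n choose (j - 1)) * pochhammer x j * pochhammer y j
     * pochhammer (d + of_nat j) (Suc n - j) * pochhammer s (Suc n - j)" for j
  define G where "G j = of_nat j * (s + of_nat n - of_nat j) * F n j" for j
  have IH: "(\<Sum>j\<le>n. F n j) = pochhammer (d - x) n * pochhammer (d - y) n"
    using Suc.IH by (simp add: F_def s_def)
  have pascal: "F (Suc n) j = (d + of_nat n) * (s + of_nat n - of_nat j) * F n j
                  + (if j = 0 then 0 else B j)" if le: "j \<le> n" for j
  proof -
    obtain r where r: "n = j + r" using le_Suc_ex[OF le] by blast
    have binom: "of_nat (Suc n choose j)
        = (of_nat (n choose j) + (if j = 0 then 0 else of_nat (n choose (j - 1))) :: 'a)"
      by (cases j) simp_all
    have diff: "Suc n - j = Suc r" "n - j = r" using r by auto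
    have len: "d + of_nat j + of_nat r = d + of_nat n" "s + of_nat r = s + of_nat n - of_nat j"
      by (simp_all add: r)
    show ?thesis
      unfolding F_def B_def binom diff pochhammer_Suc len
      by (simp add: distrib_left distrib_right mult_ac)
  qed
  have top: "F (Suc n) (Suc n) = B (Suc n)"
    by (simp add: F_def B_def)
  have G_ends: "G 0 = 0" "G (Suc n) = 0"
    by (simp_all add: G_def F_def binomial_eq_0)
  have shift: "(x + of_nat j) * (y + of_nat j) * F n j = B (Suc j) - G (Suc j)" if "j \<le> n" for j
  proof (cases "j = n")
    case True
    show ?thesis
      unfolding True G_ends F_def B_def pochhammer_Suc[of x] pochhammer_Suc[of y]
      by (simp add: mult_ac)
  next
    case False
    with that obtain r where r: "n = Suc (j + r)"
      using less_imp_Suc_add by fastforce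
    have binom: "of_nat (Suc j) * of_nat (n choose Suc j) = (of_nat (Suc r) * of_nat (n choose j) :: 'a)"
    proof -
      have "Suc j * (n choose Suc j) = Suc r * (n choose j)"
        using binomial_absorb_comp[of n j] binomial_absorption[of j n] r by simp
      then show ?thesis by (metis of_nat_mult)
    qed
    have G: "G (Suc j) = of_nat (Suc r) * of_nat (n choose j) * pochhammer x (Suc j) * pochhammer y (Suc j)
               * pochhammer (d + of_nat (Suc j)) r * pochhammer s (Suc r)"
    proof -
      have diff: "n - Suc j = r" using r by simp
      have len: "s + of_nat n - of_nat (Suc j) = s + of_nat r" by (simp add: r)
      show ?thesis
        unfolding G_def F_def binom[symmetric] diff len pochhammer_Suc[of s] by (simp only: mult_ac)
    qed
    show ?thesis
    proof -
      \<comment> \<open>Here \<open>d + j = (d + n) - (n - j)\<close>: the first part yields \<open>B (j + 1)\<close>, the second \<open>G (j + 1)\<close>.\<close>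
      define p where "p = pochhammer (d + of_nat (Suc j)) r"
      have diff: "Suc n - Suc j = Suc r" "n - j = Suc r" "Suc j - 1 = j" using r by auto
      have "pochhammer (d + of_nat j) (Suc r) = (d + of_nat j) * p"
        by (simp add: p_def pochhammer_rec add_ac)
      moreover have "pochhammer (d + of_nat (Suc j)) (Suc r) = p * (d + of_nat j + 1 + of_nat r)"
        by (simp add: p_def pochhammer_Suc add_ac)
      ultimately have "pochhammer (d + of_nat j) (Suc r)
          = pochhammer (d + of_nat (Suc j)) (Suc r) - of_nat (Suc r) * p"
        by (simp add: algebra_simps)
      then have "(of_nat (n choose j) * pochhammer x (Suc j) * pochhammer y (Suc j) * pochhammer s (Suc r))
          * pochhammer (d + of_nat j) (Suc r)
        = (of_nat (n choose j) * pochhammer x (Suc j) * pochhammer y (Suc j) * pochhammer s (Suc r))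
          * (pochhammer (d + of_nat (Suc j)) (Suc r) - of_nat (Suc r) * p)"
        by (simp only:)
      then show ?thesis
        unfolding G F_def B_def diff p_def[symmetric] pochhammer_Suc[of x] pochhammer_Suc[of y]
        by (simp only: right_diff_distrib mult_ac)
    qed
  qed
  have step: "(d - x + of_nat n) * (d - y + of_nat n) * F n j
        = (d + of_nat n) * (s + of_nat n - of_nat j) * F n j + B (Suc j) - (G (Suc j) - G j)"
    if "j \<le> n" for j
  proof -
    have regroup: "p + (q - r) + t = p + q - (r - t)" for p q r t :: 'a
      by simp
    have "(d - x + of_nat n) * (d - y + of_nat n)
        = (d + of_nat n) * (s + of_nat n - of_nat j) + (x + of_nat j) * (y + of_nat j)
          + of_nat j * (s + of_nat n - of_nat j)"
      by (simp add: s_def algebra_simps)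
    then have "(d - x + of_nat n) * (d - y + of_nat n) * F n j
        = (d + of_nat n) * (s + of_nat n - of_nat j) * F n j
          + (x + of_nat j) * (y + of_nat j) * F n j + G j"
      by (simp add: G_def distrib_right)
    then show ?thesis by (simp only: shift[OF that] regroup)
  qed
  have tele: "(\<Sum>j\<le>n. G (Suc j) - G j) = 0"
    using G_ends sum_telescope[of G n] by (simp add: sum_subtractf)
  have "(\<Sum>j\<le>Suc n. F (Suc n) j)
      = (\<Sum>j\<le>n. (d + of_nat n) * (s + of_nat n - of_nat j) * F n j)
        + (\<Sum>j\<le>Suc n. if j = 0 then 0 else B j)"
    by (simp add: pascal top sum.distrib add.assoc)
  also have "(\<Sum>j\<le>Suc n. if j = 0 then 0 else B j) = (\<Sum>j\<le>n. B (Suc j))"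
    by (subst sum.atMost_Suc_shift) simp
  also have "(\<Sum>j\<le>n. (d + of_nat n) * (s + of_nat n - of_nat j) * F n j) + (\<Sum>j\<le>n. B (Suc j))
      = (\<Sum>j\<le>n. (d - x + of_nat n) * (d - y + of_nat n) * F n j)"
    using tele by (simp add: step sum.distrib sum_subtractf)
  also have "\<dots> = pochhammer (d - x) (Suc n) * pochhammer (d - y) (Suc n)"
    unfolding sum_distrib_left[symmetric] IH pochhammer_Suc by (simp only: mult_ac)
  finally show ?case by (simp add: F_def s_def)
qed

lemma pochhammer_reflect:
  fixes z :: "'a::comm_ring_1"
  shows "pochhammer (1 - z - of_nat n) n = (- 1) ^ n * pochhammer z n"
  using pochhammer_minus[of "z + of_nat n - 1" n] by (simp add: algebra_simps)

text \<open>
  The shape in which the sum meets Whipple's transformation: the balancing condition makes \<open>f\<close> the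
  reflection of \<open>e - a - s\<close>, and reflecting the corresponding rising factorials in
  \<open>saalschuetz\<close> produces the signs.
\<close>

lemma saalschuetz_alternating:
  fixes a s e f :: "'a::comm_ring_1"
  assumes "e + f + of_nat n = a + s + 1"
  shows "(\<Sum>i\<le>n. (- 1) ^ i * of_nat (n choose i) * pochhammer a i * pochhammer s i
            * pochhammer (e + of_nat i) (n - i) * pochhammer (f + of_nat i) (n - i))
         = pochhammer (e - a) n * pochhammer (f - a) n"
proof -
  have f: "f = 1 - (e - a - s) - of_nat n"
    using assms by (simp add: algebra_simps)
  have reflect: "(- 1) ^ i * pochhammer (f + of_nat i) (n - i) = (- 1) ^ n * pochhammer (e - a - s) (n - i)"
    if "i \<le> n" for i
  proof -
    have "f + of_nat i = 1 - (e - a - s) - of_nat (n - i)"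
      using that by (simp add: f of_nat_diff)
    then have "pochhammer (f + of_nat i) (n - i) = (- 1) ^ (n - i) * pochhammer (e - a - s) (n - i)"
      by (simp only: pochhammer_reflect)
    moreover have "(- 1 :: 'a) ^ i * (- 1) ^ (n - i) = (- 1) ^ n"
      using that by (simp flip: power_add)
    ultimately show ?thesis by (metis mult.assoc)
  qed
  have "f - a = 1 - (e - s) - of_nat n"
    by (simp add: f algebra_simps)
  then have rhs: "pochhammer (f - a) n = (- 1) ^ n * pochhammer (e - s) n"
    by (simp only: pochhammer_reflect)
  have "(\<Sum>i\<le>n. (- 1) ^ i * of_nat (n choose i) * pochhammer a i * pochhammer s i
            * pochhammer (e + of_nat i) (n - i) * pochhammer (f + of_nat i) (n - i))
      = (\<Sum>i\<le>n. (- 1) ^ n * (of_nat (n choose i) * pochhammer a i * pochhammer s i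
            * pochhammer (e + of_nat i) (n - i) * pochhammer (e - a - s) (n - i)))"
  proof (rule sum.cong[OF refl])
    fix i assume "i \<in> {..n}"
    then have "i \<le> n" by simp
    have "(- 1) ^ i * of_nat (n choose i) * pochhammer a i * pochhammer s i
            * pochhammer (e + of_nat i) (n - i) * pochhammer (f + of_nat i) (n - i)
      = of_nat (n choose i) * pochhammer a i * pochhammer s i * pochhammer (e + of_nat i) (n - i)
            * ((- 1) ^ i * pochhammer (f + of_nat i) (n - i))"
      by (simp only: mult_ac)
    also have "\<dots> = (- 1) ^ n * (of_nat (n choose i) * pochhammer a i * pochhammer s i
            * pochhammer (e + of_nat i) (n - i) * pochhammer (e - a - s) (n - i))"
      unfolding reflect[OF \<open>i \<le> n\<close>] by (simp only: mult_ac)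
    finally show "(- 1) ^ i * of_nat (n choose i) * pochhammer a i * pochhammer s i
            * pochhammer (e + of_nat i) (n - i) * pochhammer (f + of_nat i) (n - i) = \<dots>" .
  qed
  also have "\<dots> = pochhammer (e - a) n * pochhammer (f - a) n"
    unfolding sum_distrib_left[symmetric] saalschuetz rhs by (simp only: mult_ac)
  finally show ?thesis .
qed

section \<open>Whipple's transformation of balanced series\<close>

lemma sum_swap_triangle:
  fixes g :: "nat \<Rightarrow> nat \<Rightarrow> 'a::comm_monoid_add"
  shows "(\<Sum>k\<le>n. \<Sum>j\<le>k. g k j) = (\<Sum>j\<le>n. \<Sum>k\<in>{j..n}. g k j)"
  by (simp add: sum.Sigma, rule sum.reindex_bij_witness[where i = prod.swap and j = prod.swap]) auto

text \<open>
  Multiplying by \<open>(e)\<^sub>n(f)\<^sub>n\<close> has removed \<open>e\<close> and \<open>f\<close> from the denominators, so only \<open>d\<close> must not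
  run into a zero.  Expanding \<open>(b)\<^sub>k(c)\<^sub>k/(d)\<^sub>k\<close> by \<open>saalschuetz\<close> and exchanging the sums leaves
  an inner sum over \<open>k \<ge> j\<close> that is balanced again, with \<open>a + j\<close>, \<open>e + j\<close>, \<open>f + j\<close>, \<open>n - j\<close> in place
  of \<open>a\<close>, \<open>e\<close>, \<open>f\<close>, \<open>n\<close>.
\<close>

lemma whipple:
  fixes a b c d e f :: "'a::field_char_0"
  assumes balanced: "d + e + f + of_nat n = a + b + c + 1"
    and d: "pochhammer d n \<noteq> 0"
  shows "(\<Sum>k\<le>n. (- 1) ^ k * of_nat (n choose k) * pochhammer a k * pochhammer b k * pochhammer c k
            / pochhammer d k * pochhammer (e + of_nat k) (n - k) * pochhammer (f + of_nat k) (n - k))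
       = (\<Sum>j\<le>n. (- 1) ^ j * of_nat (n choose j) * pochhammer a j
            * pochhammer (d - b) j * pochhammer (d - c) j / pochhammer d j
            * pochhammer (e - a) (n - j) * pochhammer (f - a) (n - j))"
proof -
  define s where "s = b + c - d"
  define w where "w j = pochhammer (d - b) j * pochhammer (d - c) j / pochhammer d j" for j
  define t where "t k = (- 1) ^ k * of_nat (n choose k) * pochhammer a k
      * pochhammer (e + of_nat k) (n - k) * pochhammer (f + of_nat k) (n - k)" for k
  have d_nz: "pochhammer d k \<noteq> 0" if "k \<le> n" for k
    using d pochhammer_product[OF that, of d] by auto
  have expand: "pochhammer b k * pochhammer c k / pochhammer d k
      = (\<Sum>j\<le>k. of_nat (k choose j) * w j * pochhammer s (k - j))" if "k \<le> n" for k
  proof -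
    have "pochhammer b k * pochhammer c k
        = (\<Sum>j\<le>k. of_nat (k choose j) * pochhammer (d - b) j * pochhammer (d - c) j
            * pochhammer (d + of_nat j) (k - j) * pochhammer s (k - j))"
      using saalschuetz[of k "d - b" "d - c" d] by (simp add: s_def algebra_simps)
    then have "pochhammer b k * pochhammer c k / pochhammer d k
        = (\<Sum>j\<le>k. of_nat (k choose j) * pochhammer (d - b) j * pochhammer (d - c) j
            * pochhammer (d + of_nat j) (k - j) * pochhammer s (k - j) / pochhammer d k)"
      by (simp add: sum_divide_distrib)
    also have "\<dots> = (\<Sum>j\<le>k. of_nat (k choose j) * w j * pochhammer s (k - j))"
    proof (rule sum.cong[OF refl])
      fix j assume "j \<in> {..k}"
      then have "j \<le> k" by simp
      then show "of_nat (k choose j) * pochhammer (d - b) j * pochhammer (d - c) j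
            * pochhammer (d + of_nat j) (k - j) * pochhammer s (k - j) / pochhammer d k
          = of_nat (k choose j) * w j * pochhammer s (k - j)"
        using pochhammer_product[of j k d] d_nz[OF that] by (simp add: w_def)
    qed
    finally show ?thesis .
  qed
  have inner: "(\<Sum>k\<in>{j..n}. t k * (of_nat (k choose j) * w j * pochhammer s (k - j)))
      = (- 1) ^ j * of_nat (n choose j) * pochhammer a j * w j
          * pochhammer (e - a) (n - j) * pochhammer (f - a) (n - j)" if "j \<le> n" for j
  proof -
    have "(\<Sum>k\<in>{j..n}. t k * (of_nat (k choose j) * w j * pochhammer s (k - j)))
        = (\<Sum>i\<le>n - j. t (i + j) * (of_nat ((i + j) choose j) * w j * pochhammer s i))"
      using that sum.shift_bounds_cl_nat_ivl
          [of "\<lambda>k. t k * (of_nat (k choose j) * w j * pochhammer s (k - j))" 0 j "n - j"]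
      by (simp add: atMost_atLeast0)
    also have "\<dots> = (\<Sum>i\<le>n - j. (- 1) ^ j * of_nat (n choose j) * pochhammer a j * w j *
        ((- 1) ^ i * of_nat ((n - j) choose i) * pochhammer (a + of_nat j) i * pochhammer s i
         * pochhammer (e + of_nat j + of_nat i) (n - j - i)
         * pochhammer (f + of_nat j + of_nat i) (n - j - i)))"
    proof (rule sum.cong[OF refl])
      fix i assume "i \<in> {..n - j}"
      then have ij: "i + j \<le> n" using that by simp
      have "(n choose (i + j)) * ((i + j) choose j) = (n choose j) * ((n - j) choose i)"
        using choose_mult[of j "i + j" n] ij by simp
      then have binom: "of_nat (n choose (i + j)) * of_nat ((i + j) choose j)
          = (of_nat (n choose j) * of_nat ((n - j) choose i) :: 'a)"
        by (metis of_nat_mult)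
      have a: "pochhammer a (i + j) = pochhammer a j * pochhammer (a + of_nat j) i"
        using pochhammer_product'[of a j i] by (simp add: add.commute)
      have idx: "n - j - i = n - (i + j)" by simp
      have "t (i + j) * (of_nat ((i + j) choose j) * w j * pochhammer s i)
         = (of_nat (n choose (i + j)) * of_nat ((i + j) choose j)) * ((- 1) ^ (i + j) * pochhammer a (i + j)
           * pochhammer (e + of_nat (i + j)) (n - (i + j)) * pochhammer (f + of_nat (i + j)) (n - (i + j))
           * w j * pochhammer s i)"
        by (simp add: t_def mult_ac)
      then show "t (i + j) * (of_nat ((i + j) choose j) * w j * pochhammer s i)
          = (- 1) ^ j * of_nat (n choose j) * pochhammer a j * w j *
        ((- 1) ^ i * of_nat ((n - j) choose i) * pochhammer (a + of_nat j) i * pochhammer s i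
         * pochhammer (e + of_nat j + of_nat i) (n - j - i)
         * pochhammer (f + of_nat j + of_nat i) (n - j - i))"
        unfolding binom a idx by (simp add: power_add add_ac mult_ac)
    qed
    also have "\<dots> = (- 1) ^ j * of_nat (n choose j) * pochhammer a j * w j
        * (pochhammer (e - a) (n - j) * pochhammer (f - a) (n - j))"
    proof -
      have "e + of_nat j + (f + of_nat j) + of_nat (n - j) = a + of_nat j + s + 1"
        using balanced that by (simp add: s_def of_nat_diff algebra_simps)
      from saalschuetz_alternating[OF this] show ?thesis
        by (simp add: sum_distrib_left[symmetric])
    qed
    finally show ?thesis by (simp add: mult.assoc)
  qed
  have "(\<Sum>k\<le>n. (- 1) ^ k * of_nat (n choose k) * pochhammer a k * pochhammer b k * pochhammer c k
            / pochhammer d k * pochhammer (e + of_nat k) (n - k) * pochhammer (f + of_nat k) (n - k))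
      = (\<Sum>k\<le>n. t k * (pochhammer b k * pochhammer c k / pochhammer d k))"
    by (simp add: t_def mult_ac)
  also have "\<dots> = (\<Sum>k\<le>n. \<Sum>j\<le>k. t k * (of_nat (k choose j) * w j * pochhammer s (k - j)))"
    by (simp add: expand sum_distrib_left)
  also have "\<dots> = (\<Sum>j\<le>n. \<Sum>k\<in>{j..n}. t k * (of_nat (k choose j) * w j * pochhammer s (k - j)))"
    by (rule sum_swap_triangle)
  also have "\<dots> = (\<Sum>j\<le>n. (- 1) ^ j * of_nat (n choose j) * pochhammer a j * w j
          * pochhammer (e - a) (n - j) * pochhammer (f - a) (n - j))"
    by (simp add: inner)
  finally show ?thesis by (simp add: w_def mult_ac)
qed

lemma pochhammer_neg_of_nat:
  "pochhammer (- of_nat n) k = (- 1) ^ k * of_nat (n choose k) * (fact k :: 'a::field_char_0)"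
  using gbinomial_pochhammer[of "of_nat n :: 'a" k]
  by (simp add: binomial_gbinomial)

lemma pochhammer_truncate:
  fixes z :: "'a::comm_ring_1"
  assumes "j \<le> n"
  shows "pochhammer z n = (- 1) ^ j * pochhammer z (n - j) * pochhammer (1 - z - of_nat n) j"
proof -
  have "pochhammer z n = pochhammer z (n - j) * pochhammer (z + of_nat (n - j)) j"
    using pochhammer_product[of "n - j" n z] assms by simp
  also have "z + of_nat (n - j) = 1 - (1 - z - of_nat n) - of_nat j"
    using assms by (simp add: of_nat_diff)
  finally show ?thesis
    unfolding pochhammer_reflect by (simp only: mult_ac)
qed

text \<open>
  The transformation in terms of series.  The bound \<open>r\<close> allows the right-hand series to stop
  where \<open>(d - b)\<^sub>j\<close> begins to vanish, so that its denominators have to be nonzero only up to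
  \<open>r\<close>; in the application the genericity assumption says nothing about later ones.
\<close>

lemma whipple_4F3:
  fixes a b c d e f :: "'a::field_char_0"
  assumes balanced: "d + e + f + of_nat n = a + b + c + 1"
    and nz: "pochhammer d n \<noteq> 0" "pochhammer e n \<noteq> 0" "pochhammer f n \<noteq> 0"
    and cut: "\<And>j. r < j \<Longrightarrow> j \<le> n \<Longrightarrow> pochhammer (d - b) j = 0" and "r \<le> n"
    and nz': "\<And>j. j \<le> r \<Longrightarrow> pochhammer (a - e + 1 - of_nat n) j \<noteq> 0"
             "\<And>j. j \<le> r \<Longrightarrow> pochhammer (a - f + 1 - of_nat n) j \<noteq> 0"
  shows "(\<Sum>k\<le>n. pochhammer (- of_nat n) k * pochhammer a k * pochhammer b k * pochhammer c k
            / (fact k * pochhammer d k * pochhammer e k * pochhammer f k))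
       = pochhammer (e - a) n * pochhammer (f - a) n / (pochhammer e n * pochhammer f n)
         * (\<Sum>j\<le>r. pochhammer (- of_nat n) j * pochhammer a j
              * pochhammer (d - b) j * pochhammer (d - c) j
            / (fact j * pochhammer d j * pochhammer (a - e + 1 - of_nat n) j
               * pochhammer (a - f + 1 - of_nat n) j))"
    (is "?L = ?C * ?R")
proof -
  define t where "t j = (- 1) ^ j * of_nat (n choose j) * pochhammer a j
            * pochhammer (d - b) j * pochhammer (d - c) j / pochhammer d j
            * pochhammer (e - a) (n - j) * pochhammer (f - a) (n - j)" for j
  have "?L * (pochhammer e n * pochhammer f n)
      = (\<Sum>k\<le>n. (- 1) ^ k * of_nat (n choose k) * pochhammer a k * pochhammer b k * pochhammer c k
            / pochhammer d k * pochhammer (e + of_nat k) (n - k) * pochhammer (f + of_nat k) (n - k))"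
    unfolding sum_distrib_right
  proof (rule sum.cong[OF refl])
    fix k assume "k \<in> {..n}"
    then have k: "k \<le> n" by simp
    have "pochhammer e k \<noteq> 0" "pochhammer f k \<noteq> 0"
      using nz pochhammer_product[OF k, of e] pochhammer_product[OF k, of f] by auto
    then show "pochhammer (- of_nat n) k * pochhammer a k * pochhammer b k * pochhammer c k
            / (fact k * pochhammer d k * pochhammer e k * pochhammer f k)
            * (pochhammer e n * pochhammer f n)
       = (- 1) ^ k * of_nat (n choose k) * pochhammer a k * pochhammer b k * pochhammer c k
            / pochhammer d k * pochhammer (e + of_nat k) (n - k) * pochhammer (f + of_nat k) (n - k)"
      unfolding pochhammer_neg_of_nat pochhammer_product[OF k, of e] pochhammer_product[OF k, of f]
      by simp
  qed
  also have "\<dots> = (\<Sum>j\<le>n. t j)"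
    unfolding t_def by (rule whipple[OF balanced nz(1)])
  also have "\<dots> = (\<Sum>j\<le>r. t j)"
    using \<open>r \<le> n\<close> by (intro sum.mono_neutral_right) (auto simp: t_def cut)
  also have "\<dots> = pochhammer (e - a) n * pochhammer (f - a) n * ?R"
    unfolding sum_distrib_left
  proof (rule sum.cong[OF refl])
    fix j assume "j \<in> {..r}"
    then have j: "j \<le> r" "j \<le> n" using \<open>r \<le> n\<close> by auto
    have e: "pochhammer (e - a) n
        = (- 1) ^ j * pochhammer (e - a) (n - j) * pochhammer (a - e + 1 - of_nat n) j"
      using pochhammer_truncate[OF j(2), of "e - a"] by (simp add: algebra_simps)
    have f: "pochhammer (f - a) n
        = (- 1) ^ j * pochhammer (f - a) (n - j) * pochhammer (a - f + 1 - of_nat n) j"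
      using pochhammer_truncate[OF j(2), of "f - a"] by (simp add: algebra_simps)
    show "t j = pochhammer (e - a) n * pochhammer (f - a) n
         * (pochhammer (- of_nat n) j * pochhammer a j * pochhammer (d - b) j * pochhammer (d - c) j
            / (fact j * pochhammer d j * pochhammer (a - e + 1 - of_nat n) j
               * pochhammer (a - f + 1 - of_nat n) j))"
      using nz'[OF j(1)] unfolding e f t_def pochhammer_neg_of_nat
      by (simp flip: power_mult_distrib)
  qed
  finally show ?thesis
    using nz by (simp add: field_simps)
qed

section \<open>The two overlaps\<close>

lemma pochhammer_neg_of_nat_diff_eq_0:
  fixes n N :: nat
  assumes "n \<le> N" "N - n < k"
  shows "pochhammer (real n - real N) k = 0"
  using pochhammer_of_nat_eq_0_lemma[OF assms(2), where ?'a = real] assms(1) by (simp add: of_nat_diff)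

lemma Z_mat_mult_vec:
  assumes v: "v \<in> carrier_vec (N + 1)" and l: "l \<le> N"
  shows "(Z_mat \<alpha> N *\<^sub>v v) $ l = (real l - \<alpha>) * v $ l + (if l = 0 then 0 else v $ (l - 1))"
proof -
  have entry: "Z_mat \<alpha> N $$ (l, j) = (if j = l then real l - \<alpha> else 0) + (if l = Suc j then 1 else 0)"
    if "j < N + 1" for j
    using l that unfolding Z_mat_def
    by (simp add: mat_of_cols_index unit_vec_def del: upt_Suc)
  have "dim_row (Z_mat \<alpha> N) = N + 1" "dim_col (Z_mat \<alpha> N) = N + 1"
    by (simp_all add: Z_mat_def)
  then have "(Z_mat \<alpha> N *\<^sub>v v) $ l = (\<Sum>j\<in>{0..<N + 1}. Z_mat \<alpha> N $$ (l, j) * v $ j)"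
    using v l by (simp add: scalar_prod_def)
  also have "\<dots>
      = (\<Sum>j\<in>{0..<N + 1}. (if j = l then (real l - \<alpha>) * v $ l else 0)
          + (if j = l - 1 then (if l = 0 then 0 else v $ (l - 1)) else 0))"
    by (rule sum.cong) (auto simp: entry)
  also have "\<dots> = (real l - \<alpha>) * v $ l + (if l = 0 then 0 else v $ (l - 1))"
    using l by (auto simp: sum.distrib)
  finally show ?thesis .
qed

text \<open>
  With \<open>A = n - N\<close>, \<open>B = \<alpha> - N\<close> and \<open>c = A - \<alpha> + \<beta> + 1\<close> the entries of \<open>|d\<^sub>n\<rangle>\<close> are proportional to
  \<open>h k = (A)\<^sub>k(B)\<^sub>k/(c)\<^sub>k\<close>, and those of \<open>Z|d\<^sub>n\<rangle>\<close> to \<open>h (k + 1) - (B + k) h k\<close>.  Both terms contain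
  \<open>(A)\<^sub>k(B)\<^sub>k\<^sub>+\<^sub>1/(c)\<^sub>k\<^sub>+\<^sub>1\<close>, with the factors \<open>A + k\<close> and \<open>c + k\<close>, and the difference of
  these factors is the constant \<open>A - c = \<alpha> - \<beta> - 1\<close>.
\<close>

lemma Z_mat_mult_d_vec:
  fixes \<alpha> \<beta> :: real
  assumes n: "n \<le> N" and k: "k \<le> N"
    and gap: "\<alpha> - \<beta> - 1 \<noteq> 0"
    and nz: "\<And>j. j \<le> N \<Longrightarrow> pochhammer (real n - real N - \<alpha> + \<beta> + 1) j \<noteq> 0"
  shows "(Z_mat \<alpha> N *\<^sub>v d_vec \<alpha> \<beta> N n) $ (N - k)
       = pochhammer (real n - real N - \<alpha> + \<beta> + 1) (N - n)
           / mpoch [real n - real N, \<alpha> - real N] (N - n)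
         * ((\<alpha> - \<beta> - 1) * (\<alpha> - real N) / (real n - real N - \<alpha> + \<beta> + 1))
         * (pochhammer (real n - real N) k * pochhammer (\<alpha> - real N + 1) k
            / pochhammer (real n - real N - \<alpha> + \<beta> + 2) k)"
proof -
  define c where "c = real n - real N - \<alpha> + \<beta> + 1"
  define A where "A = real n - real N"
  define B where "B = \<alpha> - real N"
  define P where "P = pochhammer c (N - n) / mpoch [A, B] (N - n)"
  define h where "h j = pochhammer A j * pochhammer B j / pochhammer c j" for j
  \<comment> \<open>This zero lets the row \<open>l = 0\<close>, which has no entry before it, follow the general pattern.\<close>
  have A_Suc: "pochhammer A (Suc N) = 0"
    unfolding A_def by (rule pochhammer_neg_of_nat_diff_eq_0) (use n in auto)
  have entry: "d_vec \<alpha> \<beta> N n $ l = P * h (N - l)" if "l \<le> N" for l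
    using that by (simp add: d_vec_def P_def h_def mpoch_def A_def B_def c_def)
  have "d_vec \<alpha> \<beta> N n \<in> carrier_vec (N + 1)"
    by (simp add: d_vec_def)
  then have "(Z_mat \<alpha> N *\<^sub>v d_vec \<alpha> \<beta> N n) $ (N - k)
      = (real (N - k) - \<alpha>) * (P * h k) + (if N - k = 0 then 0 else P * h (Suc k))"
    using k by (subst Z_mat_mult_vec) (auto simp: entry Suc_diff_Suc)
  also have "(if N - k = 0 then 0 else P * h (Suc k)) = P * h (Suc k)"
    using k A_Suc by (auto simp: h_def)
  also have "real (N - k) - \<alpha> = - (B + real k)"
    using k by (simp add: B_def of_nat_diff)
  also have "- (B + real k) * (P * h k) + P * h (Suc k) = P * (h (Suc k) - (B + real k) * h k)"
    by (simp add: algebra_simps)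
  also have "h (Suc k) - (B + real k) * h k
      = (A - c) * B / c * (pochhammer A k * pochhammer (B + 1) k / pochhammer (c + 1) k)"
  proof (cases "pochhammer c (Suc k) = 0")
    case False
    have ck: "pochhammer c k \<noteq> 0" "c + real k \<noteq> 0"
      using False by (auto simp: pochhammer_Suc)
    have "h (Suc k) - (B + real k) * h k
        = pochhammer A k * (pochhammer B k * (B + real k)) * (A - c) / (pochhammer c k * (c + real k))"
      using ck by (simp add: h_def pochhammer_Suc divide_simps) (simp add: algebra_simps)
    also have "pochhammer B k * (B + real k) = B * pochhammer (B + 1) k"
      by (simp flip: pochhammer_Suc add: pochhammer_rec)
    also have "pochhammer c k * (c + real k) = c * pochhammer (c + 1) k"
      by (simp flip: pochhammer_Suc add: pochhammer_rec)
    finally show ?thesis by (simp add: mult_ac)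
  next
    case True
    \<comment> \<open>Only \<open>(c)\<^sub>N\<^sub>+\<^sub>1\<close> may vanish, and not for \<open>n = 0\<close>, where its last factor is
      \<open>1 - \<alpha> + \<beta>\<close>; for \<open>n > 0\<close> both sides contain \<open>(A)\<^sub>N = 0\<close>.\<close>
    then have "k = N" using nz[of "Suc k"] k by (force simp: c_def)
    moreover have "n \<noteq> 0"
    proof
      assume "n = 0"
      then have "c + real N \<noteq> 0" using gap by (simp add: c_def)
      with True \<open>k = N\<close> nz[of N] show False by (simp add: pochhammer_Suc c_def)
    qed
    ultimately have "pochhammer A k = 0"
      unfolding A_def using n by (intro pochhammer_neg_of_nat_diff_eq_0) auto
    then show ?thesis by (simp add: h_def pochhammer_Suc)
  qed
  also have "A - c = \<alpha> - \<beta> - 1" by (simp add: A_def c_def)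
  also have "c + 1 = real n - real N - \<alpha> + \<beta> + 2" by (simp add: c_def)
  finally show ?thesis
    by (simp add: P_def A_def B_def c_def mult_ac)
qed

lemma e_vec_d_dual_vec:
  assumes "m \<le> N" "n \<le> N"
  shows "e_vec \<alpha> \<beta> \<zeta> N m \<bullet> d_dual_vec \<alpha> \<beta> N n =
        pochhammer (\<alpha> - \<beta> - real n) n * mpoch [- real N, real N - 2 * \<alpha> - \<beta> - 2 * \<zeta>] m
        / (fact n * pochhammer (- \<alpha>) (n + 1) * pochhammer (real m - 2 * \<beta> - 2 * \<zeta> - 1) m)
        * racah_U m n \<alpha> \<beta> \<zeta> N"
    (is "_ = ?C * _")
proof -
  define t where "t l = mpoch [- real m, - real n, - \<alpha>, real m - 2 * \<beta> - 2 * \<zeta> - 1] l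
        / (fact l * mpoch [- real N, \<alpha> - \<beta> - real n, real N - 2 * \<alpha> - \<beta> - 2 * \<zeta>] l)" for l
  have entry: "e_vec \<alpha> \<beta> \<zeta> N m $ l * d_dual_vec \<alpha> \<beta> N n $ l = ?C * t l" if "l < N + 1" for l
  proof -
    have "(- 1) ^ l * (- 1) ^ l = (1 :: real)"
      by (simp flip: power_mult_distrib)
    moreover have "e_vec \<alpha> \<beta> \<zeta> N m $ l * d_dual_vec \<alpha> \<beta> N n $ l
        = ((- 1) ^ l * (- 1) ^ l) * (?C * t l)"
      using that by (simp add: e_vec_def d_dual_vec_def t_def mpoch_def algebra_simps)
    ultimately show ?thesis by simp
  qed
  have "e_vec \<alpha> \<beta> \<zeta> N m \<bullet> d_dual_vec \<alpha> \<beta> N n = (\<Sum>l\<in>{0..<N + 1}. ?C * t l)"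
    unfolding scalar_prod_def by (rule sum.cong) (simp_all add: entry d_dual_vec_def[THEN arg_cong[where f = dim_vec]])
  also have "\<dots> = ?C * (\<Sum>l\<in>{0..<N + 1}. t l)"
    by (rule sum_distrib_left[symmetric])
  also have "(\<Sum>l\<in>{0..<N + 1}. t l) = (\<Sum>l\<in>{0..min m n}. t l)"
  proof (rule sum.mono_neutral_right)
    show "\<forall>l\<in>{0..<N + 1} - {0..min m n}. t l = 0"
      by (auto simp: t_def mpoch_def not_le pochhammer_of_nat_eq_0_lemma)
  qed (use assms in auto)
  finally show ?thesis
    by (simp add: racah_U_def t_def)
qed

text \<open>
  Whipple's transformation is applied with \<open>d = -N\<close>, \<open>b = m - N\<close> and \<open>c\<close> the parameter named \<open>q\<close>
  below; then \<open>d - b = -m\<close> and \<open>d - q = m - 2\<beta> - 2\<zeta> - 1\<close> are the two parameters of the Racah function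
  that depend on \<open>m\<close>.
\<close>

lemma e_dual_vec_Z_d_vec:
  assumes N: "N > 0" and gen: "generic \<alpha> \<beta> \<zeta> N" and m: "m \<le> N" and n: "n \<le> N"
  shows "e_dual_vec \<alpha> \<beta> \<zeta> N m \<bullet> (Z_mat \<alpha> N *\<^sub>v d_vec \<alpha> \<beta> N n) =
        (real n - \<alpha>)
        * mpoch [- real N + \<alpha> + \<beta> + 2 * \<zeta>, - real N + 2 * \<alpha> - \<beta>] (N - n)
        * mpoch [real m + 1, - 2 * real N + 2 * \<alpha> + \<beta> + 2 * \<zeta> + 1] (N - m)
        / (mpoch [real n - real N, real n - \<alpha>, - 2 * real N + 2 * \<alpha> + \<beta> + 2 * \<zeta> + 1] (N - n)
           * pochhammer (- real N - real m + 2 * \<beta> + 2 * \<zeta> + 1) (N - m))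
        * racah_U_tilde m n \<alpha> \<beta> \<zeta> N"
proof -
  define M where "M = N - n"
  have rM: "real M = real N - real n" using n by (simp add: M_def of_nat_diff)
  define a where "a = \<alpha> - real N + 1"
  define b where "b = real m - real N"
  define q where "q = 2 * \<beta> + 2 * \<zeta> - real N - real m + 1"
  define e where "e = - 2 * real N + 2 * \<alpha> + \<beta> + 2 * \<zeta> + 1"
  define c where "c = real n - real N - \<alpha> + \<beta> + 1"
  define f where "f = c + 1"
  define PE where "PE = mpoch [- real N, real m + real N - 2 * \<alpha> - \<beta> - 2 * \<zeta>] (N - m)
      / pochhammer q (N - m)"
  define PD where "PD = pochhammer c M / (pochhammer (real n - real N) M * pochhammer (\<alpha> - real N) M)"
  have c_nz: "pochhammer c j \<noteq> 0" if "j \<le> N" for j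
  proof -
    have "N - (N - j) = j" "N - j \<le> N" using that by auto
    then show ?thesis using gen n unfolding generic_def c_def by metis
  qed
  \<comment> \<open>This is the genericity of \<open>|d\<^sub>1\<^sup>*\<rangle>\<close>, which exists because \<open>N > 0\<close>.\<close>
  have "pochhammer (- 1 + \<alpha> - \<beta>) 1 \<noteq> 0"
    using gen N unfolding generic_def by (metis Suc_leI One_nat_def of_nat_1)
  then have gap: "\<alpha> - \<beta> - 1 \<noteq> 0" by simp
  have "mpoch [real n - real N, real n - \<alpha>, - 2 * real N + 2 * \<alpha> + \<beta> + 2 * \<zeta> + 1] M \<noteq> 0"
    using gen n unfolding generic_def M_def by blast
  then have nz: "pochhammer e M \<noteq> 0" "pochhammer (real n - real N) M \<noteq> 0" "pochhammer (real n - \<alpha>) M \<noteq> 0"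
    by (auto simp: mpoch_def e_def)
  have "mpoch [real n - real N, \<alpha> - real N] M \<noteq> 0"
    using gen n unfolding generic_def M_def by blast
  then have B_nz: "pochhammer (\<alpha> - real N) M \<noteq> 0" by (simp add: mpoch_def)
  have N_nz: "pochhammer (- real N) M \<noteq> 0"
    by (simp add: pochhammer_neg_of_nat M_def)
  \<comment> \<open>The factor \<open>1/c\<close> left by \<open>Z\<close> turns \<open>(c + 1)\<^sub>M\<close> back into \<open>(c)\<^sub>M\<close>; the surplus last factor
    cancels \<open>\<alpha> - \<beta> - 1\<close> up to sign.\<close>
  have cf: "c * pochhammer f M = - pochhammer c M * (\<alpha> - \<beta> - 1)"
  proof -
    have "c * pochhammer f M = pochhammer c M * (c + real M)"
      unfolding f_def by (simp flip: pochhammer_Suc add: pochhammer_rec)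
    also have "c + real M = - (\<alpha> - \<beta> - 1)" by (simp add: c_def rM)
    finally show ?thesis by (simp only: mult_minus_left mult_minus_right)
  qed
  have f_nz: "pochhammer f M \<noteq> 0"
    using cf c_nz[of M] gap by (auto simp: M_def)
  have rac: "pochhammer (a - e + 1 - real M) j \<noteq> 0 \<and> pochhammer (a - f + 1 - real M) j \<noteq> 0"
    if "j \<le> min m M" for j
  proof -
    have "racah_U_defined m M (real N - \<alpha> - 1) (\<beta> + 2 * \<zeta> - 2) (2 - \<zeta>) N"
      using gen m n unfolding generic_def M_def by blast
    then have "mpoch [- real N, real N - \<alpha> - 1 - (\<beta> + 2 * \<zeta> - 2) - real M,
        real N - 2 * (real N - \<alpha> - 1) - (\<beta> + 2 * \<zeta> - 2) - 2 * (2 - \<zeta>)] j \<noteq> 0"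
      using that unfolding racah_U_defined_def by blast
    moreover have "a - e + 1 - real M = real N - \<alpha> - 1 - (\<beta> + 2 * \<zeta> - 2) - real M"
      and "a - f + 1 - real M
        = real N - 2 * (real N - \<alpha> - 1) - (\<beta> + 2 * \<zeta> - 2) - 2 * (2 - \<zeta>)"
      by (simp_all add: a_def e_def f_def c_def rM)
    ultimately show ?thesis by (simp only: mpoch_def list.map prod_list.Cons mult_eq_0_iff) blast
  qed
  have e_dual_entry: "e_dual_vec \<alpha> \<beta> \<zeta> N m $ l = PE * (pochhammer b (N - l) * pochhammer q (N - l)
      / (fact (N - l) * (pochhammer (- real N) (N - l) * pochhammer e (N - l))))" if "l \<le> N" for l
  proof -
    have "2 * \<alpha> + \<beta> + 2 * \<zeta> - 2 * real N + 1 = e" by (simp add: e_def)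
    then show ?thesis
      using that by (simp add: e_dual_vec_def PE_def mpoch_def b_def q_def)
  qed
  have "e_dual_vec \<alpha> \<beta> \<zeta> N m \<bullet> (Z_mat \<alpha> N *\<^sub>v d_vec \<alpha> \<beta> N n)
      = (\<Sum>l\<le>N. e_dual_vec \<alpha> \<beta> \<zeta> N m $ l * (Z_mat \<alpha> N *\<^sub>v d_vec \<alpha> \<beta> N n) $ l)"
    by (simp add: scalar_prod_def Z_mat_def atLeast0LessThan lessThan_Suc_atMost)
  also have "\<dots> = (\<Sum>k\<le>N. e_dual_vec \<alpha> \<beta> \<zeta> N m $ (N - k) * (Z_mat \<alpha> N *\<^sub>v d_vec \<alpha> \<beta> N n) $ (N - k))"
    using sum.atLeastAtMost_rev[of
        "\<lambda>l. e_dual_vec \<alpha> \<beta> \<zeta> N m $ l * (Z_mat \<alpha> N *\<^sub>v d_vec \<alpha> \<beta> N n) $ l" 0 N]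
    by (simp only: atMost_atLeast0 add_0_right)
  also have "\<dots> = (\<Sum>k\<le>N. PE * PD * ((\<alpha> - \<beta> - 1) * (\<alpha> - real N) / c)
      * (pochhammer (- real M) k * pochhammer a k * pochhammer b k * pochhammer q k
          / (fact k * pochhammer (- real N) k * pochhammer e k * pochhammer f k)))"
  proof (rule sum.cong[OF refl])
    fix k assume "k \<in> {..N}"
    then have k: "k \<le> N" by simp
    have "N - (N - k) = k" using k by simp
    then have 1: "e_dual_vec \<alpha> \<beta> \<zeta> N m $ (N - k)
        = PE * (pochhammer b k * pochhammer q k / (fact k * (pochhammer (- real N) k * pochhammer e k)))"
      using e_dual_entry[of "N - k"] by (simp only: diff_le_self)
    have 2: "(Z_mat \<alpha> N *\<^sub>v d_vec \<alpha> \<beta> N n) $ (N - k) = PD * ((\<alpha> - \<beta> - 1) * (\<alpha> - real N) / c)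
        * (pochhammer (- real M) k * pochhammer a k / pochhammer f k)"
    proof -
      have "real n - real N - \<alpha> + \<beta> + 2 = f" "real n - real N = - real M" "\<alpha> - real N + 1 = a"
        by (simp_all add: f_def c_def a_def rM)
      then show ?thesis
        using Z_mat_mult_d_vec[OF n k gap c_nz[unfolded c_def], folded M_def c_def]
        by (simp add: PD_def mpoch_def)
    qed
    show "e_dual_vec \<alpha> \<beta> \<zeta> N m $ (N - k) * (Z_mat \<alpha> N *\<^sub>v d_vec \<alpha> \<beta> N n) $ (N - k)
       = PE * PD * ((\<alpha> - \<beta> - 1) * (\<alpha> - real N) / c)
      * (pochhammer (- real M) k * pochhammer a k * pochhammer b k * pochhammer q k
          / (fact k * pochhammer (- real N) k * pochhammer e k * pochhammer f k))"
      unfolding 1 2 by (simp add: mult_ac)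
  qed
  also have "\<dots> = PE * PD * ((\<alpha> - \<beta> - 1) * (\<alpha> - real N) / c)
      * (\<Sum>k\<le>M. pochhammer (- real M) k * pochhammer a k * pochhammer b k * pochhammer q k
          / (fact k * pochhammer (- real N) k * pochhammer e k * pochhammer f k))"
    unfolding sum_distrib_left
    by (rule sum.mono_neutral_right) (auto simp: M_def pochhammer_of_nat_eq_0_lemma)
  also have "(\<Sum>k\<le>M. pochhammer (- real M) k * pochhammer a k * pochhammer b k * pochhammer q k
          / (fact k * pochhammer (- real N) k * pochhammer e k * pochhammer f k))
     = pochhammer (e - a) M * pochhammer (f - a) M / (pochhammer e M * pochhammer f M)
         * (\<Sum>j\<le>min m M. pochhammer (- real M) j * pochhammer a j
              * pochhammer (- real N - b) j * pochhammer (- real N - q) j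
            / (fact j * pochhammer (- real N) j * pochhammer (a - e + 1 - real M) j
               * pochhammer (a - f + 1 - real M) j))"
  proof (rule whipple_4F3)
    show "- real N + e + f + real M = a + b + q + 1"
      by (simp add: a_def b_def q_def e_def f_def c_def rM)
    show "min m M \<le> M" by simp
    fix j
    show "pochhammer (a - e + 1 - real M) j \<noteq> 0" "pochhammer (a - f + 1 - real M) j \<noteq> 0"
      if "j \<le> min m M" using rac[OF that] by auto
    show "pochhammer (- real N - b) j = 0" if "min m M < j" "j \<le> M"
      using that by (simp add: b_def pochhammer_of_nat_eq_0_lemma)
  qed (use N_nz nz f_nz in auto)
  also have "(\<Sum>j\<le>min m M. pochhammer (- real M) j * pochhammer a j
              * pochhammer (- real N - b) j * pochhammer (- real N - q) j
            / (fact j * pochhammer (- real N) j * pochhammer (a - e + 1 - real M) j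
               * pochhammer (a - f + 1 - real M) j)) = racah_U_tilde m n \<alpha> \<beta> \<zeta> N"
  proof -
    have "- (real N - \<alpha> - 1) = a" "- real m = - real N - b"
      "real m - 2 * (\<beta> + 2 * \<zeta> - 2) - 2 * (2 - \<zeta>) - 1 = - real N - q"
      "real N - \<alpha> - 1 - (\<beta> + 2 * \<zeta> - 2) - real M = a - e + 1 - real M"
      "real N - 2 * (real N - \<alpha> - 1) - (\<beta> + 2 * \<zeta> - 2) - 2 * (2 - \<zeta>) = a - f + 1 - real M"
      by (simp_all add: a_def b_def q_def e_def f_def c_def rM)
    then show ?thesis
      unfolding racah_U_tilde_def racah_U_def M_def[symmetric] atMost_atLeast0
      by (simp only: mpoch_def list.map prod_list.Cons prod_list.Nil mult_1_left mult_1_right mult_ac)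
  qed
  finally have "e_dual_vec \<alpha> \<beta> \<zeta> N m \<bullet> (Z_mat \<alpha> N *\<^sub>v d_vec \<alpha> \<beta> N n)
      = PE * (PD * ((\<alpha> - \<beta> - 1) * (\<alpha> - real N) / c) * pochhammer (f - a) M / pochhammer f M)
        * (pochhammer (e - a) M / pochhammer e M) * racah_U_tilde m n \<alpha> \<beta> \<zeta> N"
    by (simp add: mult_ac)
  also have "PE = mpoch [real m + 1, e] (N - m) / pochhammer (- real N - real m + 2 * \<beta> + 2 * \<zeta> + 1) (N - m)"
  proof -
    have arg: "real m + real N - 2 * \<alpha> - \<beta> - 2 * \<zeta> = 1 - e - real (N - m)"
      "- real N = 1 - (real m + 1) - real (N - m)"
      using m by (simp_all add: e_def of_nat_diff)
    have "pochhammer (real m + real N - 2 * \<alpha> - \<beta> - 2 * \<zeta>) (N - m) = (- 1) ^ (N - m) * pochhammer e (N - m)"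
      unfolding arg(1) by (rule pochhammer_reflect)
    moreover have "pochhammer (- real N) (N - m) = (- 1) ^ (N - m) * pochhammer (real m + 1) (N - m)"
      unfolding arg(2) by (rule pochhammer_reflect)
    ultimately have "mpoch [- real N, real m + real N - 2 * \<alpha> - \<beta> - 2 * \<zeta>] (N - m) = mpoch [real m + 1, e] (N - m)"
      by (simp add: mpoch_def mult_ac)
    moreover have "q = - real N - real m + 2 * \<beta> + 2 * \<zeta> + 1"
      by (simp add: q_def)
    ultimately show ?thesis by (simp only: PE_def)
  qed
  also have "PD * ((\<alpha> - \<beta> - 1) * (\<alpha> - real N) / c) * pochhammer (f - a) M / pochhammer f M
      = (real n - \<alpha>) * pochhammer (- real N + 2 * \<alpha> - \<beta>) M
        / (pochhammer (real n - real N) M * pochhammer (real n - \<alpha>) M)"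
  proof -
    define \<sigma> where "\<sigma> = (- 1 :: real) ^ M"
    \<comment> \<open>Reflecting \<open>(f - a)\<^sub>M\<close> and \<open>(\<alpha> - N)\<^sub>M\<close> produces the same sign, in the numerator and in the
      denominator.\<close>
    have "f - a = 1 - (- real N + 2 * \<alpha> - \<beta>) - real M"
      by (simp add: f_def c_def a_def rM)
    then have fa: "pochhammer (f - a) M = \<sigma> * pochhammer (- real N + 2 * \<alpha> - \<beta>) M"
      by (simp only: pochhammer_reflect \<sigma>_def)
    have "\<alpha> - real N = 1 - (real n - \<alpha> + 1) - real M"
      by (simp add: rM)
    then have "pochhammer (\<alpha> - real N) M = \<sigma> * pochhammer (real n - \<alpha> + 1) M"
      by (simp only: pochhammer_reflect \<sigma>_def)
    moreover have "(real n - \<alpha>) * pochhammer (real n - \<alpha> + 1) M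
        = pochhammer (real n - \<alpha>) M * (real N - \<alpha>)"
      using pochhammer_rec[of "real n - \<alpha>" M] pochhammer_Suc[of "real n - \<alpha>" M] by (simp add: rM)
    ultimately have "(real n - \<alpha>) * pochhammer (\<alpha> - real N) M
        = \<sigma> * (pochhammer (real n - \<alpha>) M * (real N - \<alpha>))"
      by (metis mult.left_commute)
    then have "(real n - \<alpha>) * pochhammer (\<alpha> - real N) M
        = - \<sigma> * (\<alpha> - real N) * pochhammer (real n - \<alpha>) M"
      by (simp add: algebra_simps)
    then have "\<sigma> * (\<alpha> - real N) / pochhammer (\<alpha> - real N) M
        = - (real n - \<alpha>) / pochhammer (real n - \<alpha>) M"
      using nz B_nz by (simp add: field_simps)
    moreover have "pochhammer c M * (\<alpha> - \<beta> - 1) / (c * pochhammer f M) = - 1"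
      unfolding cf using c_nz[of M] gap by (simp add: M_def)
    moreover have "PD * ((\<alpha> - \<beta> - 1) * (\<alpha> - real N) / c) * pochhammer (f - a) M / pochhammer f M
      = (pochhammer c M * (\<alpha> - \<beta> - 1) / (c * pochhammer f M))
        * (\<sigma> * (\<alpha> - real N) / pochhammer (\<alpha> - real N) M)
        * (pochhammer (- real N + 2 * \<alpha> - \<beta>) M / pochhammer (real n - real N) M)"
      unfolding fa PD_def by (simp add: mult_ac)
    ultimately show ?thesis by simp
  qed
  also have "e - a = - real N + \<alpha> + \<beta> + 2 * \<zeta>"
    by (simp add: e_def a_def)
  finally show ?thesis
    unfolding M_def[symmetric] e_def[symmetric] by (simp add: mpoch_def mult_ac)
qed

theorem proposition5:
  fixes N :: nat and \<alpha> \<beta> \<zeta> :: real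
  assumes "N > 0" and "generic \<alpha> \<beta> \<zeta> N"
  shows "\<forall>m\<in>{0..N}. \<forall>n\<in>{0..N}.
      e_vec \<alpha> \<beta> \<zeta> N m \<bullet> d_dual_vec \<alpha> \<beta> N n =
        pochhammer (\<alpha> - \<beta> - real n) n * mpoch [- real N, real N - 2 * \<alpha> - \<beta> - 2 * \<zeta>] m
        / (fact n * pochhammer (- \<alpha>) (n + 1) * pochhammer (real m - 2 * \<beta> - 2 * \<zeta> - 1) m)
        * racah_U m n \<alpha> \<beta> \<zeta> N
    \<and> e_dual_vec \<alpha> \<beta> \<zeta> N m \<bullet> (Z_mat \<alpha> N *\<^sub>v d_vec \<alpha> \<beta> N n) =
        (real n - \<alpha>)
        * mpoch [- real N + \<alpha> + \<beta> + 2 * \<zeta>, - real N + 2 * \<alpha> - \<beta>] (N - n)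
        * mpoch [real m + 1, - 2 * real N + 2 * \<alpha> + \<beta> + 2 * \<zeta> + 1] (N - m)
        / (mpoch [real n - real N, real n - \<alpha>, - 2 * real N + 2 * \<alpha> + \<beta> + 2 * \<zeta> + 1] (N - n)
           * pochhammer (- real N - real m + 2 * \<beta> + 2 * \<zeta> + 1) (N - m))
        * racah_U_tilde m n \<alpha> \<beta> \<zeta> N"
  by (intro ballI conjI e_vec_d_dual_vec e_dual_vec_Z_d_vec[OF assms]) simp_all

end
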